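(* Assume $0\in I\subseteq\mathbb{R}_+$ or $I=\mathbb{R}$ (resp. $0\in I\subseteq\mathbb{R}_-$ or $I=\mathbb{R}$). A function $f\colon I^n\to\mathbb{R}$ is comonotonically additive if and only if it is horizontally min-additive (resp. horizontally max-additive). In this case, $\delta_f$ is additive and $\delta_f^A|_{I_+}$ (resp. $\delta_f^A|_{I_-}$) is additive for every $A\subseteq[n]$.
   Context: $n\geq 1$ is an integer, $[n]=\{1,\ldots,n\}$, $S_n$ is the set of permutations of $[n]$, and $I$ is a nontrivial (i.e., of positive measure) real interval, possibly unbounded, containing $0$. $\mathbb{R}_+=[0,+\infty[$, $\mathbb{R}_-=\,]-\infty,0]$, $I_+=I\cap\mathbb{R}_+$, $I_-=I\cap\mathbb{R}_-$. For $\sigma\in S_n$, $I^n_\sigma=\{\mathbf{x}\in I^n : x_{\sigma(1)}\leq\cdots\leq x_{\sigma(n)}\}$. For $A\subseteq[n]$, $\mathbf{1}_A$ is the $n$-tuple whose $i$th component is $1$ if $i\in A$ and $0$ otherwise; $\delta_f^A\colon I\to\mathbb{R}$ is defined by $\delta_f^A(x)=f(x\mathbf{1}_A)$, and $\delta_f=\delta_f^{[n]}$. A function $u\colon K\to\mathbb{R}$ on an interval $K$ is additive if $u(x+x')=u(x)+u(x')$ whenever $x,x',x+x'\in K$. Two $n$-tuples $\mathbf{x},\mathbf{x}'\in I^n$ are comonotonic if there is $\sigma\in S_n$ such that $\mathbf{x},\mathbf{x}'\in I^n_\sigma$. The function $f$ is comonotonically additive if $f(\mathbf{x}+\mathbf{x}')=f(\mathbf{x})+f(\mathbf{x}')$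 for all comonotonic $\mathbf{x},\mathbf{x}'\in I^n$ such that $\mathbf{x}+\mathbf{x}'\in I^n$. For $\mathbf{x}\in I^n$ and $c\in I$, $\mathbf{x}\wedge c$ (resp. $\mathbf{x}\vee c$) is the $n$-tuple whose $i$th component is $\min(x_i,c)$ (resp. $\max(x_i,c)$); put $[\mathbf{x}]_c=\mathbf{x}-(\mathbf{x}\wedge c)$ and $[\mathbf{x}]^c=\mathbf{x}-(\mathbf{x}\vee c)$. The function $f$ is horizontally min-additive if $f(\mathbf{x})=f(\mathbf{x}\wedge c)+f([\mathbf{x}]_c)$ for every $\mathbf{x}\in I^n$ and every $c\in I$ such that $[\mathbf{x}]_c\in I^n$. It is horizontally max-additive if $f(\mathbf{x})=f(\mathbf{x}\vee c)+f([\mathbf{x}]^c)$ for every $\mathbf{x}\in I^n$ and every $c\in I$ such that $[\mathbf{x}]^c\in I^n$. *)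

theory Defs
  imports "HOL-Analysis.Analysis" "HOL-Combinatorics.Permutations"
begin

text \<open>
  An n-tuple is a function on \<^term>\<open>{1..n}\<close>, extended by \<^term>\<open>undefined\<close> outside of it
  (\<^const>\<open>PiE\<close>), so that each tuple has exactly one representation. A function from the cube
  to the reals is a total function of which only the values on the cube are ever used.
\<close>

definition cube :: "nat \<Rightarrow> real set \<Rightarrow> (nat \<Rightarrow> real) set" where
  "cube n I = {1..n} \<rightarrow>\<^sub>E I"

definition tuple_add :: "nat \<Rightarrow> (nat \<Rightarrow> real) \<Rightarrow> (nat \<Rightarrow> real) \<Rightarrow> (nat \<Rightarrow> real)" where
  "tuple_add n x y = (\<lambda>i\<in>{1..n}. x i + y i)"

definition tuple_diff :: "nat \<Rightarrow> (nat \<Rightarrow> real) \<Rightarrow> (nat \<Rightarrow> real) \<Rightarrow> (nat \<Rightarrow> real)" where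
  "tuple_diff n x y = (\<lambda>i\<in>{1..n}. x i - y i)"

definition tuple_scale :: "nat \<Rightarrow> real \<Rightarrow> (nat \<Rightarrow> real) \<Rightarrow> (nat \<Rightarrow> real)" where
  "tuple_scale n r x = (\<lambda>i\<in>{1..n}. r * x i)"

definition tuple_min :: "nat \<Rightarrow> (nat \<Rightarrow> real) \<Rightarrow> real \<Rightarrow> (nat \<Rightarrow> real)" where
  "tuple_min n x c = (\<lambda>i\<in>{1..n}. min (x i) c)"

definition tuple_max :: "nat \<Rightarrow> (nat \<Rightarrow> real) \<Rightarrow> real \<Rightarrow> (nat \<Rightarrow> real)" where
  "tuple_max n x c = (\<lambda>i\<in>{1..n}. max (x i) c)"

text \<open>
  For a tuple x and a level c, \<open>lower_rest\<close> is \<open>[x]\<^sub>c = x - min(x, c)\<close> and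
  \<open>upper_rest\<close> is \<open>[x]\<^sup>c = x - max(x, c)\<close>: lower and upper refer to the position of c.
\<close>

definition lower_rest :: "nat \<Rightarrow> (nat \<Rightarrow> real) \<Rightarrow> real \<Rightarrow> (nat \<Rightarrow> real)" where
  "lower_rest n x c = tuple_diff n x (tuple_min n x c)"

definition upper_rest :: "nat \<Rightarrow> (nat \<Rightarrow> real) \<Rightarrow> real \<Rightarrow> (nat \<Rightarrow> real)" where
  "upper_rest n x c = tuple_diff n x (tuple_max n x c)"

definition char_tuple :: "nat \<Rightarrow> nat set \<Rightarrow> (nat \<Rightarrow> real)" where
  "char_tuple n A = (\<lambda>i\<in>{1..n}. if i \<in> A then 1 else 0)"

definition delta :: "nat \<Rightarrow> ((nat \<Rightarrow> real) \<Rightarrow> real) \<Rightarrow> nat set \<Rightarrow> real \<Rightarrow> real" where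
  "delta n f A x = f (tuple_scale n x (char_tuple n A))"

definition additive_on :: "real set \<Rightarrow> (real \<Rightarrow> real) \<Rightarrow> bool" where
  "additive_on K u \<longleftrightarrow>
     (\<forall>x\<in>K. \<forall>x'\<in>K. x + x' \<in> K \<longrightarrow> u (x + x') = u x + u x')"

definition ordered_cube :: "nat \<Rightarrow> real set \<Rightarrow> (nat \<Rightarrow> nat) \<Rightarrow> (nat \<Rightarrow> real) set" where
  "ordered_cube n I \<sigma> = {x \<in> cube n I. mono_on {1..n} (\<lambda>i. x (\<sigma> i))}"

definition comonotonic ::
    "nat \<Rightarrow> real set \<Rightarrow> (nat \<Rightarrow> real) \<Rightarrow> (nat \<Rightarrow> real) \<Rightarrow> bool" where
  "comonotonic n I x x' \<longleftrightarrow>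
     (\<exists>\<sigma>. \<sigma> permutes {1..n} \<and> x \<in> ordered_cube n I \<sigma> \<and> x' \<in> ordered_cube n I \<sigma>)"

definition comonotonically_additive ::
    "nat \<Rightarrow> real set \<Rightarrow> ((nat \<Rightarrow> real) \<Rightarrow> real) \<Rightarrow> bool" where
  "comonotonically_additive n I f \<longleftrightarrow>
     (\<forall>x\<in>cube n I. \<forall>x'\<in>cube n I.
        comonotonic n I x x' \<longrightarrow> tuple_add n x x' \<in> cube n I \<longrightarrow>
        f (tuple_add n x x') = f x + f x')"

definition horizontally_min_additive ::
    "nat \<Rightarrow> real set \<Rightarrow> ((nat \<Rightarrow> real) \<Rightarrow> real) \<Rightarrow> bool" where
  "horizontally_min_additive n I f \<longleftrightarrow>
     (\<forall>x\<in>cube n I. \<forall>c\<in>I. lower_rest n x c \<in> cube n I \<longrightarrow>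
        f x = f (tuple_min n x c) + f (lower_rest n x c))"

definition horizontally_max_additive ::
    "nat \<Rightarrow> real set \<Rightarrow> ((nat \<Rightarrow> real) \<Rightarrow> real) \<Rightarrow> bool" where
  "horizontally_max_additive n I f \<longleftrightarrow>
     (\<forall>x\<in>cube n I. \<forall>c\<in>I. upper_rest n x c \<in> cube n I \<longrightarrow>
        f x = f (tuple_max n x c) + f (upper_rest n x c))"

end

theory Submission
  imports Defs
begin

text \<open>
  Two tuples are comonotonic exactly when no pair of coordinates is ordered strictly one way by
  the first tuple and strictly the other way by the second (\<open>comonotonic_iff\<close>). Hence a
  comonotonically additive function splits along \<open>x = min(x, c) + [x]\<^sub>c\<close>, because both summands
  are nondecreasing functions of the coordinates of \<open>x\<close>.

  For the converse, cut \<open>x\<close> and \<open>x'\<close> at the levels \<open>c = x\<^sub>i\<close> and \<open>c' = x'\<^sub>i\<close>, where \<open>i\<close> is an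
  index at which both tuples are smallest; such an index exists by comonotonicity. All three tuples
  \<open>x\<close>, \<open>x'\<close> and \<open>x + x'\<close> then lose a constant tuple, with values \<open>c\<close>, \<open>c'\<close> and \<open>c + c'\<close>, on which
  \<open>f\<close> is additive, and the remainders are nonnegative and still comonotonic. Repeating this on the
  union of the supports of the remainders removes at least one index from that union each time, each
  step costing only the additivity of \<open>\<delta>\<^sub>f\<^sup>A\<close> at nonnegative arguments, \<open>A\<close> being the union. The
  additivity of \<open>\<delta>\<^sub>f\<^sup>A\<close> is itself an instance of horizontal min-additivity: cut \<open>(a + b) 1\<^sub>A\<close> at
  level \<open>a\<close>.

  The only property of the interval that this uses, besides containing zero, is that \<open>a - b\<close>
  belongs to it whenever \<open>a\<close> and \<open>b\<close> do and \<open>b \<le> a\<close>; it keeps all remainders inside the cube.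
  The statement about max-additivity follows by the reflection \<open>x \<mapsto> -x\<close>, \<open>I \<mapsto> -I\<close>, which exchanges
  minima with maxima.
\<close>

section \<open>Comonotonicity without permutations\<close>

lemma exists_sorting_permutation:
  fixes z :: "nat \<Rightarrow> real"
  shows "\<exists>\<sigma>. \<sigma> permutes {1..n} \<and> mono_on {1..n} (\<lambda>i. z (\<sigma> i))"
proof -
  define xs where "xs = sort_key z [1..<Suc n]"
  define \<sigma> where "\<sigma> i = (if i \<in> {1..n} then xs ! (i - 1) else i)" for i
  have len: "length xs = n" and dist: "distinct xs" and set: "set xs = {1..n}"
    and sorted: "sorted (map z xs)"
    by (auto simp: xs_def)
  have "bij_betw (\<lambda>i. i - 1) {1..n} {..<n}"
    by (rule bij_betw_byWitness[where f' = Suc]) auto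
  moreover have "bij_betw ((!) xs) {..<n} {1..n}"
    using bij_betw_nth[OF dist] len set by simp
  ultimately have "bij_betw ((!) xs \<circ> (\<lambda>i. i - 1)) {1..n} {1..n}"
    by (rule bij_betw_trans)
  then have "bij_betw \<sigma> {1..n} {1..n}"
    by (rule iffD1[OF bij_betw_cong, rotated]) (simp add: \<sigma>_def)
  then have "\<sigma> permutes {1..n}"
    by (rule bij_imp_permutes) (auto simp: \<sigma>_def)
  moreover have "mono_on {1..n} (\<lambda>i. z (\<sigma> i))"
  proof (rule mono_onI)
    fix i j assume "i \<in> {1..n}" "j \<in> {1..n}" "i \<le> j"
    then show "z (\<sigma> i) \<le> z (\<sigma> j)"
      using sorted_nth_mono[OF sorted, of "i - 1" "j - 1"] len by (auto simp: \<sigma>_def)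
  qed
  ultimately show ?thesis by blast
qed

text \<open>
  For the direction from right to left, sort the sum \<open>x + x'\<close>: if no two coordinates cross, then
  any permutation that sorts the sum sorts each summand.
\<close>

lemma comonotonic_iff:
  "comonotonic n I x x' \<longleftrightarrow>
     x \<in> cube n I \<and> x' \<in> cube n I \<and>
     (\<forall>i\<in>{1..n}. \<forall>j\<in>{1..n}. x i < x j \<longrightarrow> x' i \<le> x' j)"
  (is "_ \<longleftrightarrow> ?R")
proof
  assume "comonotonic n I x x'"
  then obtain \<sigma> where perm: "\<sigma> permutes {1..n}" and cubes: "x \<in> cube n I" "x' \<in> cube n I"
    and mono: "mono_on {1..n} (\<lambda>i. x (\<sigma> i))" "mono_on {1..n} (\<lambda>i. x' (\<sigma> i))"
    by (auto simp: comonotonic_def ordered_cube_def)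
  have "x' i \<le> x' j" if ij: "i \<in> {1..n}" "j \<in> {1..n}" "x i < x j" for i j
  proof -
    obtain p q where pq: "p \<in> {1..n}" "q \<in> {1..n}" "i = \<sigma> p" "j = \<sigma> q"
      using permutes_image[OF perm] ij by (metis imageE)
    then have "p \<le> q"
      using mono_onD[OF mono(1), of q p] ij(3) by (metis linorder_not_less nat_le_linear)
    then show ?thesis
      using mono_onD[OF mono(2), of p q] pq by simp
  qed
  with cubes show ?R by blast
next
  assume R: ?R
  obtain \<sigma> where perm: "\<sigma> permutes {1..n}" and mono: "mono_on {1..n} (\<lambda>i. x (\<sigma> i) + x' (\<sigma> i))"
    using exists_sorting_permutation[of n "\<lambda>i. x i + x' i"] by blast
  have "x (\<sigma> p) \<le> x (\<sigma> q) \<and> x' (\<sigma> p) \<le> x' (\<sigma> q)"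
    if pq: "p \<in> {1..n}" "q \<in> {1..n}" "p \<le> q" for p q
  proof -
    have le: "x (\<sigma> p) + x' (\<sigma> p) \<le> x (\<sigma> q) + x' (\<sigma> q)"
      using mono_onD[OF mono, of p q] pq by simp
    have "\<sigma> p \<in> {1..n}" "\<sigma> q \<in> {1..n}"
      using permutes_in_image[OF perm] pq by blast+
    with R have "x (\<sigma> p) < x (\<sigma> q) \<longrightarrow> x' (\<sigma> p) \<le> x' (\<sigma> q)"
      and "x (\<sigma> q) < x (\<sigma> p) \<longrightarrow> x' (\<sigma> q) \<le> x' (\<sigma> p)"
      by blast+
    with le show ?thesis by linarith
  qed
  then have "mono_on {1..n} (\<lambda>i. x (\<sigma> i))" "mono_on {1..n} (\<lambda>i. x' (\<sigma> i))"
    by (auto intro!: mono_onI)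
  with R perm show "comonotonic n I x x'"
    by (auto simp: comonotonic_def ordered_cube_def)
qed

section \<open>Horizontal cuts\<close>

lemma lower_rest_eq: "lower_rest n x c = (\<lambda>i\<in>{1..n}. max (x i - c) 0)"
  by (auto simp: lower_rest_def tuple_diff_def tuple_min_def fun_eq_iff)

lemma upper_rest_eq: "upper_rest n x c = (\<lambda>i\<in>{1..n}. min (x i - c) 0)"
  by (auto simp: upper_rest_def tuple_diff_def tuple_max_def fun_eq_iff)

lemma restrict_in_cube_iff: "restrict x {1..n} \<in> cube n I \<longleftrightarrow> (\<forall>i\<in>{1..n}. x i \<in> I)"
  by (auto simp: cube_def)

lemma cube_nth: "x \<in> cube n I \<Longrightarrow> i \<in> {1..n} \<Longrightarrow> x i \<in> I"
  by (auto simp: cube_def)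

definition diff_closed :: "real set \<Rightarrow> bool" where
  "diff_closed I \<longleftrightarrow> (\<forall>a\<in>I. \<forall>b\<in>I. b \<le> a \<longrightarrow> a - b \<in> I)"

lemma diff_closed_interval:
  assumes "is_interval I" "0 \<in> I" "I \<subseteq> {0..} \<or> I = UNIV"
  shows "diff_closed I"
  unfolding diff_closed_def
proof (intro ballI impI)
  fix a b assume ab: "a \<in> I" "b \<in> I" "b \<le> a"
  show "a - b \<in> I"
  proof (cases "I = UNIV")
    case False
    with assms(3) ab have "0 \<le> a - b" "a - b \<le> a" by auto
    then show ?thesis
      using mem_is_interval_1_I[OF assms(1) assms(2) ab(1)] by blast
  qed simp
qed

lemma lower_rest_in_cube:
  assumes "diff_closed I" "0 \<in> I" "x \<in> cube n I" "c \<in> I"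
  shows "lower_rest n x c \<in> cube n I"
  unfolding lower_rest_eq restrict_in_cube_iff using assms cube_nth[OF assms(3)]
  by (auto simp: max_def diff_closed_def)

lemma comonotonically_additive_imp_horizontally_min_additive:
  assumes "comonotonically_additive n I f"
  shows "horizontally_min_additive n I f"
  unfolding horizontally_min_additive_def
proof (intro ballI impI)
  fix x c assume x: "x \<in> cube n I" and c: "c \<in> I" and rest: "lower_rest n x c \<in> cube n I"
  have low: "tuple_min n x c \<in> cube n I"
    unfolding tuple_min_def restrict_in_cube_iff using c cube_nth[OF x] by (simp add: min_def)
  have sum: "tuple_add n (tuple_min n x c) (lower_rest n x c) = x"
    using x
    by (auto simp: tuple_add_def tuple_min_def lower_rest_eq cube_def PiE_def extensional_def
        fun_eq_iff)
  have "comonotonic n I (tuple_min n x c) (lower_rest n x c)"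
    using low rest unfolding comonotonic_iff by (auto simp: tuple_min_def lower_rest_eq)
  then show "f x = f (tuple_min n x c) + f (lower_rest n x c)"
    using assms low rest x sum unfolding comonotonically_additive_def by metis
qed

text \<open>
  The elementary move: when \<open>c\<close> is a lower bound of \<open>x\<close> on \<open>A\<close> and \<open>x\<close> vanishes off \<open>A\<close>, the part
  of \<open>x\<close> below level \<open>c\<close> is \<open>c 1\<^sub>A\<close>. Off \<open>A\<close> this needs \<open>min(0, c) = 0\<close>, so a negative
  level is possible only for the full index set.
\<close>

lemma peel_level:
  assumes "horizontally_min_additive n I f" "x \<in> cube n I" "c \<in> I" "lower_rest n x c \<in> cube n I"
    and "\<And>j. j \<in> {1..n} \<Longrightarrow> j \<in> A \<Longrightarrow> c \<le> x j"
    and "\<And>j. j \<in> {1..n} \<Longrightarrow> j \<notin> A \<Longrightarrow> x j = 0"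
    and "0 \<le> c \<or> {1..n} \<subseteq> A"
  shows "f x = delta n f A c + f (lower_rest n x c)"
proof -
  have "tuple_min n x c = tuple_scale n c (char_tuple n A)"
    using assms(5-7)
    by (fastforce simp: tuple_min_def tuple_scale_def char_tuple_def fun_eq_iff)
  then show ?thesis
    using assms(1-4) by (simp add: horizontally_min_additive_def delta_def)
qed

lemma delta_add_nonneg_right:
  assumes "horizontally_min_additive n I f" "0 \<in> I" "a \<in> I" "b \<in> I" "a + b \<in> I"
    and "0 \<le> b" "0 \<le> a \<or> {1..n} \<subseteq> A"
  shows "delta n f A (a + b) = delta n f A a + delta n f A b"
proof -
  let ?x = "tuple_scale n (a + b) (char_tuple n A)"
  have rest: "lower_rest n ?x a = tuple_scale n b (char_tuple n A)"
    using assms(6,7)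
    by (auto simp: lower_rest_eq tuple_scale_def char_tuple_def fun_eq_iff)
  have "f ?x = delta n f A a + f (lower_rest n ?x a)"
  proof (rule peel_level[OF assms(1)])
    show "?x \<in> cube n I" "lower_rest n ?x a \<in> cube n I"
      unfolding rest unfolding tuple_scale_def restrict_in_cube_iff
      using assms(2,4,5) by (auto simp: char_tuple_def)
  qed (use assms in \<open>auto simp: tuple_scale_def char_tuple_def\<close>)
  then show ?thesis
    by (simp add: rest delta_def)
qed

lemma delta_additive_nonneg:
  assumes "horizontally_min_additive n I f" "0 \<in> I"
  shows "additive_on (I \<inter> {0..}) (delta n f A)"
  using delta_add_nonneg_right[OF assms] by (auto simp: additive_on_def)

text \<open>
  On the full index set one nonnegative summand is enough, since the cut may be made at a
  negative level. Two negative summands reduce to two positive ones, because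
  \<open>\<delta>\<^sub>f\<close> is odd by the case \<open>a + (-a) = 0\<close>.
\<close>

lemma delta_full_additive:
  assumes hmin: "horizontally_min_additive n I f" and zero: "0 \<in> I" and diff: "diff_closed I"
  shows "additive_on I (delta n f {1..n})"
  unfolding additive_on_def
proof (intro ballI impI)
  let ?d = "delta n f {1..n}"
  have add: "?d (a + b) = ?d a + ?d b" if "a \<in> I" "b \<in> I" "a + b \<in> I" "0 \<le> b" for a b
    using delta_add_nonneg_right[OF hmin zero that] by simp
  have "?d 0 = 0"
    using add[of 0 0] zero by simp
  then have odd: "-a \<in> I \<and> ?d (-a) = - ?d a" if "a \<in> I" "a < 0" for a
    using add[of a "-a"] that zero diff unfolding diff_closed_def
    by (metis add.inverse_inverse add.right_inverse diff_0 eq_neg_iff_add_eq_0 less_eq_real_def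
        neg_0_less_iff_less add.commute)
  fix a b assume ab: "a \<in> I" "b \<in> I" "a + b \<in> I"
  consider "0 \<le> b" | "0 \<le> a" | "a < 0" "b < 0" by linarith
  then show "?d (a + b) = ?d a + ?d b"
  proof cases
    case 1
    with ab show ?thesis using add by simp
  next
    case 2
    with ab show ?thesis using add[of b a] by (simp add: add.commute)
  next
    case 3
    with odd[of a] odd[of b] odd[of "a + b"] ab add[of "-a" "-b"] show ?thesis
      by simp
  qed
qed

section \<open>Min-additivity implies comonotonic additivity\<close>

text \<open>
  Cutting at the level of an index \<open>i\<close> where both tuples are smallest is compatible with the sum:
  \<open>[x + x']\<close> at level \<open>x\<^sub>i + x'\<^sub>i\<close> is \<open>[x] + [x']\<close> at levels \<open>x\<^sub>i\<close> and \<open>x'\<^sub>i\<close>. Off \<open>A\<close>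
  nonnegative levels make all three remainders vanish.
\<close>

lemma additive_if_rests_additive:
  assumes hmin: "horizontally_min_additive n I f" and zero: "0 \<in> I" and diff: "diff_closed I"
    and cubes: "x \<in> cube n I" "x' \<in> cube n I" "tuple_add n x x' \<in> cube n I"
    and i: "i \<in> {1..n}"
    and least: "\<And>j. j \<in> {1..n} \<Longrightarrow> j \<in> A \<Longrightarrow> x i \<le> x j \<and> x' i \<le> x' j"
    and vanish: "\<And>j. j \<in> {1..n} \<Longrightarrow> j \<notin> A \<Longrightarrow> x j = 0 \<and> x' j = 0"
    and level: "0 \<le> x i \<and> 0 \<le> x' i \<or> A = {1..n}"
    and rests: "tuple_add n (lower_rest n x (x i)) (lower_rest n x' (x' i)) \<in> cube n I \<Longrightarrow>
      f (tuple_add n (lower_rest n x (x i)) (lower_rest n x' (x' i))) =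
        f (lower_rest n x (x i)) + f (lower_rest n x' (x' i))"
  shows "f (tuple_add n x x') = f x + f x'"
proof -
  let ?z = "tuple_add n x x'"
  have mem: "x i \<in> I" "x' i \<in> I" "x i + x' i \<in> I"
    using cube_nth[OF cubes(1) i] cube_nth[OF cubes(2) i] cube_nth[OF cubes(3) i] i
    by (auto simp: tuple_add_def)
  have rest_sum: "lower_rest n ?z (x i + x' i) =
      tuple_add n (lower_rest n x (x i)) (lower_rest n x' (x' i))"
  proof
    fix j
    show "lower_rest n ?z (x i + x' i) j =
        tuple_add n (lower_rest n x (x i)) (lower_rest n x' (x' i)) j"
      using least[of j] vanish[of j] level
      by (cases "j \<in> A") (auto simp: lower_rest_eq tuple_add_def)
  qed
  have cube_rests: "lower_rest n x (x i) \<in> cube n I" "lower_rest n x' (x' i) \<in> cube n I"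
    "lower_rest n ?z (x i + x' i) \<in> cube n I"
    using lower_rest_in_cube[OF diff zero] cubes mem by blast+
  have "f x = delta n f A (x i) + f (lower_rest n x (x i))"
    using peel_level[OF hmin cubes(1) mem(1) cube_rests(1)] least vanish level by blast
  moreover have "f x' = delta n f A (x' i) + f (lower_rest n x' (x' i))"
    using peel_level[OF hmin cubes(2) mem(2) cube_rests(2)] least vanish level by blast
  moreover have "f ?z = delta n f A (x i + x' i) + f (lower_rest n ?z (x i + x' i))"
    by (rule peel_level[OF hmin cubes(3) mem(3) cube_rests(3)])
      (use least vanish level in \<open>auto simp: tuple_add_def intro!: add_mono\<close>)
  moreover have "delta n f A (x i + x' i) = delta n f A (x i) + delta n f A (x' i)"
    using level
  proof
    assume "0 \<le> x i \<and> 0 \<le> x' i"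
    then show ?thesis
      using delta_additive_nonneg[OF hmin zero] mem by (auto simp: additive_on_def)
  next
    assume "A = {1..n}"
    then show ?thesis
      using delta_full_additive[OF hmin zero diff] mem by (auto simp: additive_on_def)
  qed
  ultimately show ?thesis
    using rests cube_rests(3) unfolding rest_sum by linarith
qed

text \<open>
  An index that minimises the sum \<open>x + x'\<close> minimises both tuples: otherwise one of them would be
  strictly smaller elsewhere, the other would not be larger there, and the sum would drop.
\<close>

lemma exists_common_least_index:
  fixes x x' :: "nat \<Rightarrow> real"
  assumes "A \<subseteq> {1..n}" "A \<noteq> {}"
    and "\<forall>i\<in>{1..n}. \<forall>j\<in>{1..n}. x i < x j \<longrightarrow> x' i \<le> x' j"
  obtains i where "i \<in> A" "\<And>j. j \<in> A \<Longrightarrow> x i \<le> x j \<and> x' i \<le> x' j"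
proof -
  have "finite A"
    using assms(1) finite_subset by blast
  then obtain i where i: "i \<in> A" "\<And>j. j \<in> A \<Longrightarrow> x i + x' i \<le> x j + x' j"
    using assms(2) ex_min_if_finite[of "(\<lambda>i. x i + x' i) ` A"]
    by (metis (mono_tags, lifting) arg_min_least arg_min_if_finite(1))
  have "x i \<le> x j \<and> x' i \<le> x' j" if j: "j \<in> A" for j
  proof -
    have "x i < x j \<longrightarrow> x' i \<le> x' j" "x j < x i \<longrightarrow> x' j \<le> x' i"
      using assms(1,3) i(1) j by blast+
    with i(2)[OF j] show ?thesis by linarith
  qed
  with i(1) that show ?thesis by blast
qed

lemma lower_rest_no_crossing:
  assumes "\<forall>i\<in>{1..n}. \<forall>j\<in>{1..n}. x i < x j \<longrightarrow> x' i \<le> x' j"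
  shows "\<forall>i\<in>{1..n}. \<forall>j\<in>{1..n}.
    lower_rest n x c i < lower_rest n x c j \<longrightarrow> lower_rest n x' c' i \<le> lower_rest n x' c' j"
proof (intro ballI impI)
  fix i j assume ij: "i \<in> {1..n}" "j \<in> {1..n}" "lower_rest n x c i < lower_rest n x c j"
  then have "x i < x j" by (auto simp: lower_rest_eq max_def split: if_splits)
  then have "x' i \<le> x' j" using assms ij by blast
  with ij show "lower_rest n x' c' i \<le> lower_rest n x' c' j" by (auto simp: lower_rest_eq)
qed

text \<open>
  Induction on the number of indices at which \<open>x\<close> or \<open>x'\<close> is nonzero. Cutting at the least
  values over these indices makes both remainders vanish at the minimising index.
\<close>

lemma additive_comonotonic_nonneg:
  assumes hmin: "horizontally_min_additive n I f" and zero: "0 \<in> I" and diff: "diff_closed I"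
    and "x \<in> cube n I" "x' \<in> cube n I" "tuple_add n x x' \<in> cube n I"
    and "\<forall>i\<in>{1..n}. \<forall>j\<in>{1..n}. x i < x j \<longrightarrow> x' i \<le> x' j"
    and "\<forall>i\<in>{1..n}. 0 \<le> x i \<and> 0 \<le> x' i"
  shows "f (tuple_add n x x') = f x + f x'"
  using assms(4-)
proof (induction "card {i\<in>{1..n}. x i \<noteq> 0 \<or> x' i \<noteq> 0}" arbitrary: x x' rule: less_induct)
  case less
  define A where "A = {i\<in>{1..n}. x i \<noteq> 0 \<or> x' i \<noteq> 0}"
  show ?case
  proof (cases "A = {}")
    case True
    (* All three tuples are zero, and f vanishes there because 0 + 0 = 0 and delta is additive. *)
    define w where "w = (\<lambda>i\<in>{1..n}. 0 :: real)"
    have "x = w" "x' = w" "tuple_add n x x' = w"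
      using True less.prems(1,2)
      by (auto simp: A_def w_def tuple_add_def cube_def PiE_def extensional_def fun_eq_iff)
    moreover have "w = tuple_scale n 0 (char_tuple n {})"
      by (auto simp: w_def tuple_scale_def)
    moreover have "delta n f {} (0 + 0) = delta n f {} 0 + delta n f {} 0"
      using delta_add_nonneg_right[OF hmin zero, of 0 0 "{}"] zero by simp
    ultimately show ?thesis
      by (simp add: delta_def)
  next
    case False
    have sub: "A \<subseteq> {1..n}" by (auto simp: A_def)
    obtain i where i: "i \<in> A" and least: "\<And>j. j \<in> A \<Longrightarrow> x i \<le> x j \<and> x' i \<le> x' j"
      using exists_common_least_index[OF sub False less.prems(4)] by blast
    have i_n: "i \<in> {1..n}" using i sub by blast
    let ?y = "lower_rest n x (x i)" and ?y' = "lower_rest n x' (x' i)"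
    have nonneg: "0 \<le> x j" "0 \<le> x' j" if "j \<in> {1..n}" for j
      using less.prems(5) that by auto
    (* The index i leaves the support, and no index enters it because the levels are nonnegative. *)
    have "{j\<in>{1..n}. ?y j \<noteq> 0 \<or> ?y' j \<noteq> 0} \<subseteq> A - {i}"
      using nonneg[OF i_n] by (auto simp: A_def lower_rest_eq max_def split: if_splits)
    then have smaller: "card {j\<in>{1..n}. ?y j \<noteq> 0 \<or> ?y' j \<noteq> 0} < card A"
      using i sub by (meson finite_Diff finite_subset finite_atLeastAtMost card_mono
          card_Diff1_less le_less_trans)
    have cross: "\<forall>k\<in>{1..n}. \<forall>j\<in>{1..n}. ?y k < ?y j \<longrightarrow> ?y' k \<le> ?y' j"
      using lower_rest_no_crossing[OF less.prems(4)] .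
    show ?thesis
    proof (rule additive_if_rests_additive[OF hmin zero diff less.prems(1-3) i_n, of A])
      assume "tuple_add n ?y ?y' \<in> cube n I"
      moreover have "?y \<in> cube n I" "?y' \<in> cube n I"
        using lower_rest_in_cube[OF diff zero] less.prems(1,2) cube_nth i_n by blast+
      ultimately show "f (tuple_add n ?y ?y') = f ?y + f ?y'"
        using less.hyps[of ?y ?y'] smaller cross by (auto simp: A_def lower_rest_eq)
    qed (use least nonneg[OF i_n] in \<open>auto simp: A_def\<close>)
  qed
qed

text \<open>
  One cut at the overall minimum, which may be negative, reduces the general case to nonnegative
  tuples.
\<close>

lemma horizontally_min_additive_imp_comonotonically_additive:
  assumes hmin: "horizontally_min_additive n I f" and zero: "0 \<in> I" and diff: "diff_closed I"
    and n: "n \<ge> 1"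
  shows "comonotonically_additive n I f"
  unfolding comonotonically_additive_def
proof (intro ballI impI)
  fix x x' assume cubes: "x \<in> cube n I" "x' \<in> cube n I" "tuple_add n x x' \<in> cube n I"
    and "comonotonic n I x x'"
  then have no_cross: "\<forall>i\<in>{1..n}. \<forall>j\<in>{1..n}. x i < x j \<longrightarrow> x' i \<le> x' j"
    by (simp add: comonotonic_iff)
  obtain i where i: "i \<in> {1..n}" and least: "\<And>j. j \<in> {1..n} \<Longrightarrow> x i \<le> x j \<and> x' i \<le> x' j"
    using exists_common_least_index[OF subset_refl _ no_cross] n by auto
  let ?y = "lower_rest n x (x i)" and ?y' = "lower_rest n x' (x' i)"
  show "f (tuple_add n x x') = f x + f x'"
  proof (rule additive_if_rests_additive[OF hmin zero diff cubes i, of "{1..n}"])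
    assume "tuple_add n ?y ?y' \<in> cube n I"
    moreover have "?y \<in> cube n I" "?y' \<in> cube n I"
      using lower_rest_in_cube[OF diff zero] cubes cube_nth i by blast+
    moreover have "\<forall>k\<in>{1..n}. \<forall>j\<in>{1..n}. ?y k < ?y j \<longrightarrow> ?y' k \<le> ?y' j"
      using lower_rest_no_crossing[OF no_cross] .
    ultimately show "f (tuple_add n ?y ?y') = f ?y + f ?y'"
      using additive_comonotonic_nonneg[OF hmin zero diff] by (simp add: lower_rest_eq)
  qed (use least in auto)
qed

lemma comonotonically_additive_iff_horizontally_min_additive:
  assumes "n \<ge> 1" "0 \<in> I" "diff_closed I"
  shows "comonotonically_additive n I f \<longleftrightarrow> horizontally_min_additive n I f"
  using assms comonotonically_additive_imp_horizontally_min_additive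
    horizontally_min_additive_imp_comonotonically_additive by blast

section \<open>Reflection\<close>

definition tuple_neg :: "nat \<Rightarrow> (nat \<Rightarrow> real) \<Rightarrow> nat \<Rightarrow> real" where
  "tuple_neg n x = (\<lambda>i\<in>{1..n}. - x i)"

lemma tuple_neg_in_cube: "x \<in> cube n I \<Longrightarrow> tuple_neg n x \<in> cube n (uminus ` I)"
  unfolding tuple_neg_def restrict_in_cube_iff by (blast dest: cube_nth)

lemma cube_extensional: "x \<in> cube n I \<Longrightarrow> x \<in> extensional {1..n}"
  by (simp add: cube_def PiE_def)

lemma tuple_neg_neg: "x \<in> extensional {1..n} \<Longrightarrow> tuple_neg n (tuple_neg n x) = x"
  by (auto simp: tuple_neg_def extensional_def fun_eq_iff)

lemma uminus_image_image: "uminus ` uminus ` I = (I :: real set)"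
  by (simp add: image_image)

lemma cube_uminus: "cube n (uminus ` I) = tuple_neg n ` cube n I"
proof
  show "tuple_neg n ` cube n I \<subseteq> cube n (uminus ` I)"
    using tuple_neg_in_cube by blast
  show "cube n (uminus ` I) \<subseteq> tuple_neg n ` cube n I"
  proof
    fix x assume "x \<in> cube n (uminus ` I)"
    then have "x = tuple_neg n (tuple_neg n x)" "tuple_neg n x \<in> cube n I"
      using tuple_neg_neg cube_extensional tuple_neg_in_cube[of x n "uminus ` I"]
        uminus_image_image by metis+
    then show "x \<in> tuple_neg n ` cube n I" by blast
  qed
qed

lemma tuple_neg_in_cube_iff:
  "x \<in> extensional {1..n} \<Longrightarrow> tuple_neg n x \<in> cube n (uminus ` I) \<longleftrightarrow> x \<in> cube n I"
  by (metis tuple_neg_in_cube tuple_neg_neg uminus_image_image)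

lemma comonotonic_neg:
  assumes "x \<in> cube n I" "x' \<in> cube n I"
  shows "comonotonic n (uminus ` I) (tuple_neg n x) (tuple_neg n x') \<longleftrightarrow> comonotonic n I x x'"
  using assms tuple_neg_in_cube[OF assms(1)] tuple_neg_in_cube[OF assms(2)]
  by (auto simp: comonotonic_iff tuple_neg_def)

lemma tuple_add_neg: "tuple_add n (tuple_neg n x) (tuple_neg n x') = tuple_neg n (tuple_add n x x')"
  by (auto simp: tuple_add_def tuple_neg_def)

lemma comonotonically_additive_reflect:
  "comonotonically_additive n (uminus ` I) (\<lambda>x. f (tuple_neg n x)) \<longleftrightarrow>
     comonotonically_additive n I f"
proof -
  have ext: "tuple_add n x x' \<in> extensional {1..n}" for x x'
    by (simp add: tuple_add_def)
  show ?thesis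
    unfolding comonotonically_additive_def cube_uminus ball_simps
    by (simp add: comonotonic_neg tuple_add_neg tuple_neg_neg[OF cube_extensional]
        tuple_neg_neg[OF ext] tuple_neg_in_cube_iff[OF ext]
        flip: cube_uminus cong: ball_cong imp_cong)
qed

lemma tuple_min_neg: "tuple_min n (tuple_neg n x) (-c) = tuple_neg n (tuple_max n x c)"
  by (auto simp: tuple_min_def tuple_max_def tuple_neg_def min_def max_def)

lemma lower_rest_neg: "lower_rest n (tuple_neg n x) (-c) = tuple_neg n (upper_rest n x c)"
  by (auto simp: lower_rest_eq upper_rest_eq tuple_neg_def min_def max_def)

lemma horizontally_min_additive_reflect:
  "horizontally_min_additive n (uminus ` I) (\<lambda>x. f (tuple_neg n x)) \<longleftrightarrow>
     horizontally_max_additive n I f"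
proof -
  have ext: "upper_rest n x c \<in> extensional {1..n}" "tuple_max n x c \<in> extensional {1..n}" for x c
    by (simp_all add: upper_rest_eq tuple_max_def)
  show ?thesis
    unfolding horizontally_min_additive_def horizontally_max_additive_def cube_uminus ball_simps
    by (simp add: tuple_min_neg lower_rest_neg tuple_neg_neg[OF cube_extensional]
        tuple_neg_neg[OF ext(1)] tuple_neg_neg[OF ext(2)] tuple_neg_in_cube_iff[OF ext(1)]
        flip: cube_uminus cong: ball_cong imp_cong)
qed

lemma delta_reflect:
  "delta n (\<lambda>x. f (tuple_neg n x)) A (-a) = delta n f A a"
proof -
  have "tuple_neg n (tuple_scale n (-a) (char_tuple n A)) = tuple_scale n a (char_tuple n A)"
    by (auto simp: tuple_neg_def tuple_scale_def)
  then show ?thesis by (simp add: delta_def)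
qed

lemma additive_on_reflect:
  assumes "additive_on (uminus ` K) u" "\<And>a. u (-a) = v a"
  shows "additive_on K v"
proof -
  have "v (a + b) = v a + v b" if "a \<in> K" "b \<in> K" "a + b \<in> K" for a b
  proof -
    have "-a + -b \<in> uminus ` K" using that by (metis image_eqI minus_add_distrib)
    then have "u (-a + -b) = u (-a) + u (-b)"
      using assms(1) that unfolding additive_on_def by blast
    then show ?thesis using assms(2)[of "a + b"] assms(2) by simp
  qed
  then show ?thesis by (auto simp: additive_on_def)
qed

theorem theorem5:
  fixes n :: nat and I :: "real set" and f :: "(nat \<Rightarrow> real) \<Rightarrow> real"
  assumes "n \<ge> 1"
    and "is_interval I"
    and "emeasure lborel I > 0"
    and "0 \<in> I"
  shows
    "(I \<subseteq> {0..} \<or> I = UNIV \<longrightarrow>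
        (comonotonically_additive n I f \<longleftrightarrow> horizontally_min_additive n I f) \<and>
        (comonotonically_additive n I f \<longrightarrow>
           additive_on I (delta n f {1..n}) \<and>
           (\<forall>A\<subseteq>{1..n}. additive_on (I \<inter> {0..}) (delta n f A)))) \<and>
     (I \<subseteq> {..0} \<or> I = UNIV \<longrightarrow>
        (comonotonically_additive n I f \<longleftrightarrow> horizontally_max_additive n I f) \<and>
        (comonotonically_additive n I f \<longrightarrow>
           additive_on I (delta n f {1..n}) \<and>
           (\<forall>A\<subseteq>{1..n}. additive_on (I \<inter> {..0}) (delta n f A))))"
proof (intro conjI impI)
  assume I: "I \<subseteq> {0..} \<or> I = UNIV"
  have diff: "diff_closed I"
    using diff_closed_interval assms I by blast
  show equiv: "comonotonically_additive n I f \<longleftrightarrow> horizontally_min_additive n I f"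
    using comonotonically_additive_iff_horizontally_min_additive assms diff by blast
  assume "comonotonically_additive n I f"
  with equiv have hmin: "horizontally_min_additive n I f" by blast
  show "additive_on I (delta n f {1..n})"
    using delta_full_additive[OF hmin \<open>0 \<in> I\<close> diff] .
  show "\<forall>A\<subseteq>{1..n}. additive_on (I \<inter> {0..}) (delta n f A)"
    using delta_additive_nonneg[OF hmin \<open>0 \<in> I\<close>] by blast
next
  let ?J = "uminus ` I" and ?g = "\<lambda>x. f (tuple_neg n x)"
  assume "I \<subseteq> {..0} \<or> I = UNIV"
  then have J: "?J \<subseteq> {0..} \<or> ?J = UNIV" by (auto simp: surj_uminus)
  have zero: "0 \<in> ?J" using \<open>0 \<in> I\<close> by force
  have diff: "diff_closed ?J"
    using diff_closed_interval[OF _ zero J] assms(2) by simp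
  show equiv: "comonotonically_additive n I f \<longleftrightarrow> horizontally_max_additive n I f"
    using comonotonically_additive_iff_horizontally_min_additive[OF assms(1) zero diff, of ?g]
    by (simp add: comonotonically_additive_reflect horizontally_min_additive_reflect)
  assume "comonotonically_additive n I f"
  with equiv have hmin: "horizontally_min_additive n ?J ?g"
    by (simp add: horizontally_min_additive_reflect)
  show "additive_on I (delta n f {1..n})"
    using additive_on_reflect[OF delta_full_additive[OF hmin zero diff]] delta_reflect by blast
  have "?J \<inter> {0..} = uminus ` (I \<inter> {..0})" by force
  then show "\<forall>A\<subseteq>{1..n}. additive_on (I \<inter> {..0}) (delta n f A)"
    using additive_on_reflect[of "I \<inter> {..0}"] delta_additive_nonneg[OF hmin zero] delta_reflect
    by metis
qed

end
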